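(* Let $f : \mathbb{R} \times \mathbb{R} \times [0,1] \to \mathbb{R}$, written $f(z,x)$ with $z = (z_1, z_2) \in \mathbb{R}^2$ and $x \in [0,1]$, and let $$F(y) = \int_0^1 f(y'(x), y(x), x) \, dx , \qquad y \in \mathcal{C}_0^1 .$$ Let $y^* \in \mathcal{C}_0^1$, and suppose that the following conditions hold: (S1) $f \in \mathcal{C}^2$, and $y^*$ satisfies the Euler equation $$\frac{d}{dx}\left( \frac{\partial f}{\partial z_1}\bigl({y^*}'(x), y^*(x), x\bigr) \right) = \frac{\partial f}{\partial z_2}\bigl({y^*}'(x), y^*(x), x\bigr), \qquad x \in [0,1].$$ (S2) Define, for $x \in [0,1]$, $$P(x) = \frac{\partial^2 f}{\partial z_1^2}\bigl({y^*}'(x), y^*(x), x\bigr), \qquad R(x) = \frac{\partial^2 f}{\partial z_1 \partial z_2}\bigl({y^*}'(x), y^*(x), x\bigr).$$ Then $P \in \mathcal{C}^1([0,1])$ with $P$ strictly positive on $[0,1]$, and $R \in \mathcal{C}^1([0,1])$. Define $$Q(x) = \frac{\partial^2 f}{\partial z_2^2}\bigl({y^*}'(x), y^*(x), x\bigr) - R'(x) .$$ (S3) The solution $u$ on $[0,1]$ of the initial-value problem $$\frac{d}{dx}\bigl(P(x) u'(x)\bigr) = Q(x) u(x), \qquad u(0) = 0, \quad u'(0) = 1,$$ is positive on $(0,1]$. Then $y^*$ is a strict local minimizer of $F$ over $\mathcal{C}_0^1$.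
   Context: $\mathcal{C}^k([0,1])$ denotes the $k$ times continuously differentiable real-valued functions on $[0,1]$. $\mathcal{C}_0^1$ denotes the space of continuously differentiable real-valued functions $y$ on $[0,1]$ with $y(0) = y(1) = 0$. Local minimality is with respect to the max-norm for $\mathcal{C}^1$: $y^*$ is a strict local minimizer of $F$ if there exists $\varepsilon > 0$ such that $F(y^* + h) > F(y^* )$ for every nonzero $h \in \mathcal{C}_0^1$ with $\max_{x \in [0,1]} |h(x)| + \max_{x \in [0,1]} |h'(x)| < \varepsilon$. *)

theory Defs
  imports "HOL-Analysis.Analysis"
begin

text \<open>
  Derivatives are taken within \<open>S\<close>, hence one-sided at boundary points.  They are uniquely
  determined on the sets used here, which are \<open>{0..1}\<close> and \<open>UNIV \<times> UNIV \<times> {0..1}\<close>.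
  In the successor case continuity of each \<open>\<lambda>x. f' x v\<close> amounts, on a finite-dimensional
  domain, to continuity of the derivative \<open>f'\<close> in the operator norm.
\<close>

primrec Ck_on :: "nat \<Rightarrow> 'a::real_normed_vector set \<Rightarrow> ('a \<Rightarrow> 'b::real_normed_vector) \<Rightarrow> bool" where
  "Ck_on 0 S f \<longleftrightarrow> continuous_on S f"
| "Ck_on (Suc k) S f \<longleftrightarrow>
     (\<exists>f'. (\<forall>x\<in>S. (f has_derivative f' x) (at x within S)) \<and> (\<forall>v. Ck_on k S (\<lambda>x. f' x v)))"

text \<open>
  A function on \<open>[0,1]\<close> is a total function of which only the values on \<open>{0..1}\<close> matter.
\<close>

definition D01 :: "(real \<Rightarrow> real) \<Rightarrow> real \<Rightarrow> real" where
  "D01 y x = vector_derivative y (at x within {0..1})"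

definition C1_0 :: "(real \<Rightarrow> real) set" where
  "C1_0 = {y. Ck_on 1 {0..1} y \<and> y 0 = 0 \<and> y 1 = 0}"

text \<open>
  The suprema are maxima for \<open>h\<close> in \<open>C1_0\<close>.
\<close>

definition C1_norm :: "(real \<Rightarrow> real) \<Rightarrow> real" where
  "C1_norm h = (SUP x\<in>{0..1}. \<bar>h x\<bar>) + (SUP x\<in>{0..1}. \<bar>D01 h x\<bar>)"

definition strict_local_minimizer :: "((real \<Rightarrow> real) \<Rightarrow> real) \<Rightarrow> (real \<Rightarrow> real) \<Rightarrow> bool" where
  "strict_local_minimizer F y \<longleftrightarrow>
     y \<in> C1_0 \<and>
     (\<exists>\<epsilon>>0. \<forall>h\<in>C1_0. (\<exists>x\<in>{0..1}. h x \<noteq> 0) \<longrightarrow> C1_norm h < \<epsilon> \<longrightarrow> F (\<lambda>x. y x + h x) > F y)"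

text \<open>
  The integrand takes its arguments in the order \<open>(z\<^sub>1, z\<^sub>2, x)\<close>, where \<open>z\<^sub>1\<close> stands for the
  derivative of the curve and \<open>z\<^sub>2\<close> for its value.
\<close>

type_synonym integrand = "real \<times> real \<times> real \<Rightarrow> real"

definition dz1 :: "integrand \<Rightarrow> integrand" where
  "dz1 f = (\<lambda>(a, b, x). deriv (\<lambda>s. f (s, b, x)) a)"

definition dz2 :: "integrand \<Rightarrow> integrand" where
  "dz2 f = (\<lambda>(a, b, x). deriv (\<lambda>s. f (a, s, x)) b)"

definition functional :: "integrand \<Rightarrow> (real \<Rightarrow> real) \<Rightarrow> real" where
  "functional f y = integral {0..1} (\<lambda>x. f (D01 y x, y x, x))"

definition euler_equation :: "integrand \<Rightarrow> (real \<Rightarrow> real) \<Rightarrow> bool" where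
  "euler_equation f y \<longleftrightarrow>
     (\<forall>x\<in>{0..1}. ((\<lambda>t. dz1 f (D01 y t, y t, t)) has_real_derivative dz2 f (D01 y x, y x, x))
        (at x within {0..1}))"

definition coeff_P :: "integrand \<Rightarrow> (real \<Rightarrow> real) \<Rightarrow> real \<Rightarrow> real" where
  "coeff_P f y x = dz1 (dz1 f) (D01 y x, y x, x)"

definition coeff_R :: "integrand \<Rightarrow> (real \<Rightarrow> real) \<Rightarrow> real \<Rightarrow> real" where
  "coeff_R f y x = dz1 (dz2 f) (D01 y x, y x, x)"

definition coeff_Q :: "integrand \<Rightarrow> (real \<Rightarrow> real) \<Rightarrow> real \<Rightarrow> real" where
  "coeff_Q f y x = dz2 (dz2 f) (D01 y x, y x, x) - D01 (coeff_R f y) x"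

definition jacobi_ivp :: "(real \<Rightarrow> real) \<Rightarrow> (real \<Rightarrow> real) \<Rightarrow> (real \<Rightarrow> real) \<Rightarrow> bool" where
  "jacobi_ivp P Q u \<longleftrightarrow>
     u differentiable_on {0..1} \<and>
     (\<forall>x\<in>{0..1}. ((\<lambda>t. P t * D01 u t) has_real_derivative Q x * u x) (at x within {0..1})) \<and>
     u 0 = 0 \<and> D01 u 0 = 1"

end

theory Submission
  imports Defs
begin

text \<open>
  A second-order Taylor expansion bounds \<open>F (y + h) - F y\<close> from below by the integral of
  \<open>f\<^sub>1 h' + f\<^sub>2 h + (P h'\<^sup>2 + 2 R h h' + (Q + R') h\<^sup>2) / 2 - \<eta> (h'\<^sup>2 + h\<^sup>2)\<close>, where \<open>\<eta>\<close> is small when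
  \<open>h\<close> is small in \<open>C\<^sup>1\<close>.  The first-order part is \<open>(f\<^sub>1 h)'\<close> by the Euler equation, and
  \<open>2 R h h' + R' h\<^sup>2 = (R h\<^sup>2)'\<close>.  The positive solution \<open>u\<close> of the Jacobi equation yields \<open>G\<close>
  vanishing at both endpoints with \<open>P h'\<^sup>2 + Q h\<^sup>2 \<ge> G' + c (h'\<^sup>2 + h\<^sup>2)\<close> pointwise, so that the
  integral is at least \<open>c / 4\<close> times that of \<open>h'\<^sup>2 + h\<^sup>2\<close>.
\<close>

section \<open>Derivatives on the unit interval and partial derivatives on the strip\<close>

text \<open>A derivative within \<open>S\<close> sees only values on \<open>S\<close>. This lets
  \<open>dz1 f\<close> and \<open>dz2 f\<close>, which are identified with directional derivatives
  of \<open>f\<close> on the strip only, inherit their smoothness.\<close>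

lemma Ck_on_cong:
  assumes "Ck_on k S f" and "\<And>x. x \<in> S \<Longrightarrow> g x = f x"
  shows "Ck_on k S g"
proof (cases k)
  case 0
  then show ?thesis
    using assms continuous_on_cong[of S S g f] by simp
next
  case (Suc j)
  then obtain f' where f': "\<And>x. x \<in> S \<Longrightarrow> (f has_derivative f' x) (at x within S)"
    and Ck: "\<And>v. Ck_on j S (\<lambda>x. f' x v)"
    using assms(1) by auto
  have "(g has_derivative f' x) (at x within S)" if "x \<in> S" for x
    by (rule has_derivative_transform[OF that _ f'[OF that]]) (use assms(2) in auto)
  then show ?thesis
    using Ck unfolding Suc Ck_on.simps by blast
qed

lemma D01_eqI:
  assumes "(g has_real_derivative d) (at x within {0..1})" "x \<in> {0..1}"
  shows "D01 g x = d"
  unfolding D01_def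
  by (rule vector_derivative_within_closed_interval)
     (use assms in \<open>auto simp: has_real_derivative_iff_has_vector_derivative\<close>)

text \<open>A linear map on the reals is multiplication by its value at 1, so the abstract
  derivative is determined by its value in direction 1, which is \<open>D01 g\<close>.\<close>

lemma Ck_on_1_D01:
  assumes "Ck_on 1 {0..1} g"
  shows "\<And>x. x \<in> {0..1} \<Longrightarrow> (g has_real_derivative D01 g x) (at x within {0..1})"
    and "continuous_on {0..1} (D01 g)"
proof -
  obtain g' where g': "\<And>x. x \<in> {0..1} \<Longrightarrow> (g has_derivative g' x) (at x within {0..1})"
    and cont: "continuous_on {0..1} (\<lambda>x. g' x 1)"
    using assms unfolding One_nat_def Ck_on.simps by blast
  have d: "(g has_real_derivative g' x 1) (at x within {0..1})" if "x \<in> {0..1}" for x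
  proof -
    have "g' x = (*) (g' x 1)"
    proof
      fix v
      have "linear (g' x)"
        using g'[OF that] has_derivative_linear by blast
      from linear_scale[OF this, of v 1] show "g' x v = g' x 1 * v"
        by (simp add: mult.commute)
    qed
    then show ?thesis
      using g'[OF that] unfolding has_field_derivative_def by simp
  qed
  then have eq: "D01 g x = g' x 1" if "x \<in> {0..1}" for x
    using that D01_eqI by blast
  show "(g has_real_derivative D01 g x) (at x within {0..1})" if "x \<in> {0..1}" for x
    using d eq that by simp
  show "continuous_on {0..1} (D01 g)"
    using cont eq continuous_on_cong by (metis (no_types, lifting))
qed

abbreviation (input) strip :: "(real \<times> real \<times> real) set" where
  "strip \<equiv> UNIV \<times> UNIV \<times> {0..1}"

lemma Ck_on_Suc_partials:
  assumes "Ck_on (Suc k) strip f"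
  shows "\<And>a b x. x \<in> {0..1} \<Longrightarrow> ((\<lambda>s. f (s, b, x)) has_real_derivative dz1 f (a, b, x)) (at a)"
    and "\<And>a b x. x \<in> {0..1} \<Longrightarrow> ((\<lambda>s. f (a, s, x)) has_real_derivative dz2 f (a, b, x)) (at b)"
    and "Ck_on k strip (dz1 f)" and "Ck_on k strip (dz2 f)"
proof -
  obtain f' where f': "\<And>p. p \<in> strip \<Longrightarrow> (f has_derivative f' p) (at p within strip)"
    and Ck: "\<And>v. Ck_on k strip (\<lambda>p. f' p v)"
    using assms by auto
  have line: "((\<lambda>s. f (l s)) has_real_derivative f' (l a) v) (at a)"
    if "\<And>s. l s \<in> strip" "(l has_derivative (\<lambda>t. t *\<^sub>R v)) (at a)" for l a v
  proof -
    have "((\<lambda>s. f (l s)) has_derivative (\<lambda>t. f' (l a) (t *\<^sub>R v))) (at a)"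
    proof (rule has_derivative_in_compose[OF that(2)])
      show "(f has_derivative f' (l a)) (at (l a) within range l)"
        by (rule has_derivative_subset[OF f'[OF that(1)]]) (use that(1) in blast)
    qed
    moreover have "(\<lambda>t. f' (l a) (t *\<^sub>R v)) = (*) (f' (l a) v)"
      using linear_scale[OF has_derivative_linear[OF f'[OF that(1)]], of a _ v]
      by (simp add: fun_eq_iff mult.commute)
    ultimately show ?thesis
      unfolding has_field_derivative_def by simp
  qed
  have d1: "((\<lambda>s. f (s, b, x)) has_real_derivative f' (a, b, x) (1, 0, 0)) (at a)"
    if "x \<in> {0..1}" for a b x
    by (rule line[where l = "\<lambda>s. (s, b, x)"])
       (use that in \<open>auto intro!: derivative_eq_intros simp: zero_prod_def\<close>)
  have d2: "((\<lambda>s. f (a, s, x)) has_real_derivative f' (a, b, x) (0, 1, 0)) (at b)"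
    if "x \<in> {0..1}" for a b x
    by (rule line[where l = "\<lambda>s. (a, s, x)"])
       (use that in \<open>auto intro!: derivative_eq_intros simp: zero_prod_def\<close>)
  have e1: "dz1 f (a, b, x) = f' (a, b, x) (1, 0, 0)"
    and e2: "dz2 f (a, b, x) = f' (a, b, x) (0, 1, 0)" if "x \<in> {0..1}" for a b x
    using DERIV_imp_deriv[OF d1] DERIV_imp_deriv[OF d2] that by (auto simp: dz1_def dz2_def)
  show "((\<lambda>s. f (s, b, x)) has_real_derivative dz1 f (a, b, x)) (at a)" if "x \<in> {0..1}" for a b x
    using d1 e1 that by simp
  show "((\<lambda>s. f (a, s, x)) has_real_derivative dz2 f (a, b, x)) (at b)" if "x \<in> {0..1}" for a b x
    using d2 e2 that by simp
  show "Ck_on k strip (dz1 f)"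
    by (rule Ck_on_cong[OF Ck[of "(1, 0, 0)"]]) (use e1 in auto)
  show "Ck_on k strip (dz2 f)"
    by (rule Ck_on_cong[OF Ck[of "(0, 1, 0)"]]) (use e2 in auto)
qed

lemma Ck_on_Suc_imp_continuous_on:
  "Ck_on (Suc k) S f \<Longrightarrow> continuous_on S f"
  by (auto simp: continuous_on_eq_continuous_within intro: has_derivative_continuous)

lemma Ck_on_imp_continuous_on:
  "Ck_on k S f \<Longrightarrow> continuous_on S f"
  using Ck_on_Suc_imp_continuous_on by (cases k) auto

section \<open>Second-order Taylor estimate for the integrand\<close>

text \<open>Taylor's theorem locates the intermediate point in an order that depends on the sign of
  \<open>k\<close>; the distance bound covers both signs and \<open>k = 0\<close> at once.\<close>

lemma taylor_order_2:
  fixes g g' g'' :: "real \<Rightarrow> real"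
  assumes "\<And>t. (g has_real_derivative g' t) (at t)"
    and "\<And>t. (g' has_real_derivative g'' t) (at t)"
  shows "\<exists>t. \<bar>t - a\<bar> \<le> \<bar>k\<bar> \<and> g (a + k) = g a + g' a * k + g'' t * k\<^sup>2 / 2"
proof (cases "k = 0")
  case True
  then show ?thesis by auto
next
  case False
  define D where "D n = (if n = 0 then g else if n = 1 then g' else g'')" for n :: nat
  have "\<exists>t. (if a + k < a then a + k < t \<and> t < a else a < t \<and> t < a + k) \<and>
      g (a + k) = (\<Sum>m<2. D m a / fact m * (a + k - a) ^ m) + D 2 t / fact 2 * (a + k - a)\<^sup>2"
  proof (rule Taylor[where a = "a - \<bar>k\<bar>" and b = "a + \<bar>k\<bar>"])
    show "\<forall>m t. m < 2 \<and> a - \<bar>k\<bar> \<le> t \<and> t \<le> a + \<bar>k\<bar> \<longrightarrow> DERIV (D m) t :> D (Suc m) t"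
      using assms by (auto simp: D_def less_2_cases_iff)
  qed (use False in \<open>auto simp: D_def\<close>)
  then obtain t where "if k < 0 then a + k < t \<and> t < a else a < t \<and> t < a + k"
    and "g (a + k) = g a + g' a * k + g'' t * k\<^sup>2 / 2"
    by (auto simp: D_def numeral_2_eq_2)
  then show ?thesis
    by (intro exI[of _ t]) (auto split: if_splits)
qed

text \<open>
  Expanding first in \<open>z\<^sub>2\<close> and then in \<open>z\<^sub>1\<close> produces the mixed derivative only in the order
  used by \<open>coeff_R\<close>, so its symmetry is not needed.
\<close>

lemma taylor_integrand:
  assumes f: "Ck_on 2 strip f" and "\<eta> > 0"
  shows "\<exists>\<delta>>0. \<forall>a b x k1 k2. x \<in> {0..1} \<longrightarrow> \<bar>a\<bar> \<le> B \<longrightarrow> \<bar>b\<bar> \<le> B \<longrightarrow> \<bar>k1\<bar> + \<bar>k2\<bar> < \<delta> \<longrightarrow>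
    f (a + k1, b + k2, x) - f (a, b, x) \<ge>
      dz1 f (a, b, x) * k1 + dz2 f (a, b, x) * k2
      + (dz1 (dz1 f) (a, b, x) * k1\<^sup>2 + 2 * dz1 (dz2 f) (a, b, x) * k1 * k2
         + dz2 (dz2 f) (a, b, x) * k2\<^sup>2) / 2
      - \<eta> * (k1\<^sup>2 + k2\<^sup>2)"
proof -
  have f2: "Ck_on (Suc 1) strip f"
    using f by (simp add: numeral_2_eq_2)
  note p = Ck_on_Suc_partials[OF f2]
  have c1: "Ck_on (Suc 0) strip (dz1 f)" and c2: "Ck_on (Suc 0) strip (dz2 f)"
    using p(3,4) by simp_all
  note p1 = Ck_on_Suc_partials[OF c1] and p2 = Ck_on_Suc_partials[OF c2]
  \<comment> \<open>The box is enlarged by 1 so that perturbed arguments, which move by less than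
    1/2, stay in a compact set on which \<open>g\<close> is uniformly continuous.\<close>
  let ?K = "{-(B + 1)..B + 1} \<times> {-(B + 1)..B + 1} \<times> {0..1::real}"
  have mod: "\<exists>\<delta>>0. \<delta> < 1 \<and> (\<forall>a b a' b' x. x \<in> {0..1} \<longrightarrow> \<bar>a\<bar> \<le> B \<longrightarrow> \<bar>b\<bar> \<le> B \<longrightarrow>
      \<bar>a' - a\<bar> + \<bar>b' - b\<bar> < \<delta> \<longrightarrow> \<bar>g (a', b', x) - g (a, b, x)\<bar> < \<eta>)"
    if "continuous_on strip g" for g :: "real \<times> real \<times> real \<Rightarrow> real"
  proof -
    have "uniformly_continuous_on ?K g"
      by (intro compact_uniformly_continuous continuous_on_subset[OF that] compact_Times) auto
    then obtain d where d: "d > 0"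
      "\<And>q q'. q \<in> ?K \<Longrightarrow> q' \<in> ?K \<Longrightarrow> dist q' q < d \<Longrightarrow> dist (g q') (g q) < \<eta>"
      using \<open>\<eta> > 0\<close> unfolding uniformly_continuous_on_def by meson
    show ?thesis
    proof (intro exI[of _ "min d (1/2)"] conjI allI impI)
      fix a b a' b' x :: real
      assume *: "x \<in> {0..1}" "\<bar>a\<bar> \<le> B" "\<bar>b\<bar> \<le> B" "\<bar>a' - a\<bar> + \<bar>b' - b\<bar> < min d (1/2)"
      have "dist (a', b', x) (a, b, x) \<le> \<bar>a' - a\<bar> + \<bar>b' - b\<bar>"
        unfolding dist_Pair_Pair by (simp add: dist_real_def sqrt_sum_squares_le_sum_abs)
      moreover have "(a, b, x) \<in> ?K" "(a', b', x) \<in> ?K"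
        using * by (simp_all, linarith+)
      ultimately show "\<bar>g (a', b', x) - g (a, b, x)\<bar> < \<eta>"
        using d(2)[of "(a, b, x)" "(a', b', x)"] * by (simp add: dist_real_def)
    qed (use d in auto)
  qed
  obtain d11 where d11: "d11 > 0" "d11 < 1" "\<And>a b a' b' x. x \<in> {0..1} \<Longrightarrow> \<bar>a\<bar> \<le> B \<Longrightarrow> \<bar>b\<bar> \<le> B \<Longrightarrow>
      \<bar>a' - a\<bar> + \<bar>b' - b\<bar> < d11 \<Longrightarrow> \<bar>dz1 (dz1 f) (a', b', x) - dz1 (dz1 f) (a, b, x)\<bar> < \<eta>"
    using mod[of "dz1 (dz1 f)"] p1(3) by auto
  obtain d12 where d12: "d12 > 0" "d12 < 1" "\<And>a b a' b' x. x \<in> {0..1} \<Longrightarrow> \<bar>a\<bar> \<le> B \<Longrightarrow> \<bar>b\<bar> \<le> B \<Longrightarrow>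
      \<bar>a' - a\<bar> + \<bar>b' - b\<bar> < d12 \<Longrightarrow> \<bar>dz1 (dz2 f) (a', b', x) - dz1 (dz2 f) (a, b, x)\<bar> < \<eta>"
    using mod[of "dz1 (dz2 f)"] p2(3) by auto
  obtain d22 where d22: "d22 > 0" "d22 < 1" "\<And>a b a' b' x. x \<in> {0..1} \<Longrightarrow> \<bar>a\<bar> \<le> B \<Longrightarrow> \<bar>b\<bar> \<le> B \<Longrightarrow>
      \<bar>a' - a\<bar> + \<bar>b' - b\<bar> < d22 \<Longrightarrow> \<bar>dz2 (dz2 f) (a', b', x) - dz2 (dz2 f) (a, b, x)\<bar> < \<eta>"
    using mod[of "dz2 (dz2 f)"] p2(4) by auto
  show ?thesis
  proof (intro exI[of _ "min d11 (min d12 d22)"] conjI allI impI)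
    show "min d11 (min d12 d22) > 0"
      using d11 d12 d22 by simp
  next
    fix a b x k1 k2 :: real
    assume x: "x \<in> {0..1}" and a: "\<bar>a\<bar> \<le> B" and b: "\<bar>b\<bar> \<le> B"
      and k: "\<bar>k1\<bar> + \<bar>k2\<bar> < min d11 (min d12 d22)"
    obtain s where s: "\<bar>s - a\<bar> \<le> \<bar>k1\<bar>"
      "f (a + k1, b, x) = f (a, b, x) + dz1 f (a, b, x) * k1 + dz1 (dz1 f) (s, b, x) * k1\<^sup>2 / 2"
      using taylor_order_2[of "\<lambda>s. f (s, b, x)" "\<lambda>s. dz1 f (s, b, x)"
          "\<lambda>s. dz1 (dz1 f) (s, b, x)" a k1] p(1)[OF x] p1(1)[OF x] by blast
    obtain t where t: "\<bar>t - b\<bar> \<le> \<bar>k2\<bar>"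
      "f (a + k1, b + k2, x) = f (a + k1, b, x) + dz2 f (a + k1, b, x) * k2
        + dz2 (dz2 f) (a + k1, t, x) * k2\<^sup>2 / 2"
      using taylor_order_2[of "\<lambda>s. f (a + k1, s, x)" "\<lambda>s. dz2 f (a + k1, s, x)"
          "\<lambda>s. dz2 (dz2 f) (a + k1, s, x)" b k2] p(2)[OF x] p2(2)[OF x] by blast
    \<comment> \<open>The mean value theorem in z1 moves \<open>dz2 f\<close> from
      \<open>a + k1\<close> back to \<open>a\<close>; the mixed term arises here.\<close>
    obtain r where r: "\<bar>r - a\<bar> \<le> \<bar>k1\<bar>"
      "dz2 f (a + k1, b, x) = dz2 f (a, b, x) + dz1 (dz2 f) (r, b, x) * k1"
    proof -
      have "\<exists>r. \<bar>r - a\<bar> \<le> \<bar>k1\<bar> \<and>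
          dz2 f (a + k1, b, x) = dz2 f (a, b, x) + dz1 (dz2 f) (r, b, x) * k1"
      proof (cases k1 "0 :: real" rule: linorder_cases)
        case less
        then obtain z where "z > a + k1" "z < a"
          "dz2 f (a, b, x) - dz2 f (a + k1, b, x) = (a - (a + k1)) * dz1 (dz2 f) (z, b, x)"
          using MVT2[of "a + k1" a "\<lambda>s. dz2 f (s, b, x)" "\<lambda>s. dz1 (dz2 f) (s, b, x)"]
            p2(1)[OF x] by auto
        then show ?thesis
          by (intro exI[of _ z]) (auto simp: algebra_simps)
      next
        case greater
        then obtain z where "z > a" "z < a + k1"
          "dz2 f (a + k1, b, x) - dz2 f (a, b, x) = (a + k1 - a) * dz1 (dz2 f) (z, b, x)"
          using MVT2[of a "a + k1" "\<lambda>s. dz2 f (s, b, x)" "\<lambda>s. dz1 (dz2 f) (s, b, x)"]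
            p2(1)[OF x] by auto
        then show ?thesis
          by (intro exI[of _ z]) (auto simp: algebra_simps)
      qed auto
      then show ?thesis using that by blast
    qed
    \<comment> \<open>These are the errors from evaluating second derivatives at intermediate
      points. In the halved error form the squares cost at most half of
      \<open>\<eta> * (k1\<^sup>2 + k2\<^sup>2)\<close>, and so does the mixed term, by 2 |k1 k2|
      \<le> k1^2 + k2^2.\<close>
    define e11 where "e11 = dz1 (dz1 f) (s, b, x) - dz1 (dz1 f) (a, b, x)"
    define e12 where "e12 = dz1 (dz2 f) (r, b, x) - dz1 (dz2 f) (a, b, x)"
    define e22 where "e22 = dz2 (dz2 f) (a + k1, t, x) - dz2 (dz2 f) (a, b, x)"
    have "\<bar>e11\<bar> < \<eta>"
      unfolding e11_def by (rule d11(3)[OF x a b]) (use s k in auto)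
    moreover have "\<bar>e12\<bar> < \<eta>"
      unfolding e12_def by (rule d12(3)[OF x a b]) (use r k in auto)
    moreover have "\<bar>e22\<bar> < \<eta>"
      unfolding e22_def by (rule d22(3)[OF x a b]) (use t k in auto)
    ultimately have e: "- \<eta> * k1\<^sup>2 \<le> e11 * k1\<^sup>2" "- \<eta> * k2\<^sup>2 \<le> e22 * k2\<^sup>2"
      "- \<eta> * (k1\<^sup>2 + k2\<^sup>2) \<le> 2 * (e12 * (k1 * k2))"
    proof -
      assume E: "\<bar>e11\<bar> < \<eta>" "\<bar>e12\<bar> < \<eta>" "\<bar>e22\<bar> < \<eta>"
      show "- \<eta> * k1\<^sup>2 \<le> e11 * k1\<^sup>2" "- \<eta> * k2\<^sup>2 \<le> e22 * k2\<^sup>2"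
        using E mult_right_mono[of "- \<eta>" e11 "k1\<^sup>2"] mult_right_mono[of "- \<eta>" e22 "k2\<^sup>2"]
        by simp_all
      have "\<bar>2 * (e12 * (k1 * k2))\<bar> = \<bar>e12\<bar> * (2 * (\<bar>k1\<bar> * \<bar>k2\<bar>))"
        by (simp add: abs_mult)
      also have "\<dots> \<le> \<eta> * (k1\<^sup>2 + k2\<^sup>2)"
        using E sum_squares_bound[of "\<bar>k1\<bar>" "\<bar>k2\<bar>"] by (intro mult_mono) auto
      finally show "- \<eta> * (k1\<^sup>2 + k2\<^sup>2) \<le> 2 * (e12 * (k1 * k2))"
        by linarith
    qed
    have "f (a + k1, b + k2, x) - f (a, b, x) =
      dz1 f (a, b, x) * k1 + dz2 f (a, b, x) * k2
      + (dz1 (dz1 f) (a, b, x) * k1\<^sup>2 + 2 * dz1 (dz2 f) (a, b, x) * k1 * k2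
         + dz2 (dz2 f) (a, b, x) * k2\<^sup>2) / 2
      + (e11 * k1\<^sup>2 + 2 * (e12 * (k1 * k2)) + e22 * k2\<^sup>2) / 2"
      unfolding t(2) r(2) s(2) e11_def e12_def e22_def by (simp add: field_simps)
    moreover have "(e11 * k1\<^sup>2 + 2 * (e12 * (k1 * k2)) + e22 * k2\<^sup>2) / 2 \<ge> - \<eta> * (k1\<^sup>2 + k2\<^sup>2)"
      using e by (simp add: algebra_simps)
    ultimately show "f (a + k1, b + k2, x) - f (a, b, x) \<ge>
      dz1 f (a, b, x) * k1 + dz2 f (a, b, x) * k2
      + (dz1 (dz1 f) (a, b, x) * k1\<^sup>2 + 2 * dz1 (dz2 f) (a, b, x) * k1 * k2
         + dz2 (dz2 f) (a, b, x) * k2\<^sup>2) / 2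
      - \<eta> * (k1\<^sup>2 + k2\<^sup>2)"
      by linarith
  qed
qed

section \<open>Coercivity of the second variation\<close>

lemma continuous_on_bounded_01:
  fixes g :: "real \<Rightarrow> real"
  assumes "continuous_on {0..1} g"
  obtains M where "M > 0" "\<And>x. x \<in> {0..1} \<Longrightarrow> \<bar>g x\<bar> \<le> M"
proof -
  have "bounded (g ` {0..1})"
    using assms by (intro compact_imp_bounded compact_continuous_image) auto
  then show ?thesis
    using that unfolding bounded_pos by auto
qed

text \<open>The mean value inequality between 0 and \<open>x\<close>. It gives \<open>h\<close>
  linear decay at 0, to be set against the zero of \<open>u\<close> there.\<close>

lemma abs_le_mult_of_derivative_bound:
  fixes g :: "real \<Rightarrow> real"
  assumes "\<And>x. x \<in> {0..1} \<Longrightarrow> (g has_real_derivative g' x) (at x within {0..1})"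
    and "\<And>x. x \<in> {0..1} \<Longrightarrow> \<bar>g' x\<bar> \<le> M" and "g 0 = 0" and "x \<in> {0..1}"
  shows "\<bar>g x\<bar> \<le> M * x"
  using field_differentiable_bound[of "{0..1}" g g' M x 0] assms by simp

text \<open>Near 0 the quotient \<open>u x / x\<close> tends to 1 and hence exceeds 1/2; away from 0
  the positive function \<open>u\<close> has a positive minimum by compactness. The bound keeps
  \<open>x / u x\<close> bounded at the singular endpoint.\<close>

lemma linear_lower_bound:
  fixes u :: "real \<Rightarrow> real"
  assumes d: "(u has_real_derivative 1) (at 0 within {0..1})" and "u 0 = 0"
    and cont: "continuous_on {0..1} u" and pos: "\<And>x. x \<in> {0<..1} \<Longrightarrow> u x > 0"
  obtains a where "a > 0" "\<And>x. x \<in> {0..1} \<Longrightarrow> a * x \<le> u x"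
proof -
  have "((\<lambda>x. u x / x) \<longlongrightarrow> 1) (at 0 within {0..1})"
    using d \<open>u 0 = 0\<close> by (simp add: has_field_derivative_iff)
  then have "\<forall>\<^sub>F x in at 0 within {0..1}. u x / x > 1 / 2"
    by (rule order_tendstoD) simp
  then obtain r where r: "r > 0" "\<And>x. x \<in> {0..1} \<Longrightarrow> x \<noteq> 0 \<Longrightarrow> \<bar>x\<bar> < r \<Longrightarrow> u x / x > 1 / 2"
    unfolding eventually_at dist_real_def by auto
  \<comment> \<open>The cap at 1 keeps \<open>{d..1}\<close> nonempty, so that the minimum of
    \<open>u\<close> over it is attained.\<close>
  define d where "d = min r 1"
  have d: "0 < d" "d \<le> 1" "d \<le> r"
    using r by (auto simp: d_def)
  obtain z where z: "z \<in> {d..1}" "\<And>x. x \<in> {d..1} \<Longrightarrow> u z \<le> u x"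
    using continuous_attains_inf[of "{d..1}" u] continuous_on_subset[OF cont, of "{d..1}"] d
    by auto
  have uz: "u z > 0"
    using pos z d by auto
  show ?thesis
  proof
    show "min (1 / 2) (u z) > 0"
      using uz by simp
  next
    fix x :: real assume x: "x \<in> {0..1}"
    consider "x = 0" | "0 < x" "x < d" | "d \<le> x"
      using x by fastforce
    then show "min (1 / 2) (u z) * x \<le> u x"
    proof cases
      case 1
      then show ?thesis using \<open>u 0 = 0\<close> by simp
    next
      case 2
      then have "x / 2 < u x"
        using r(2)[of x] x d by (simp add: field_simps)
      moreover have "min (1 / 2) (u z) * x \<le> (1 / 2) * x"
        using x by (intro mult_right_mono) auto
      ultimately show ?thesis by simp
    next
      case 3
      have "min (1 / 2) (u z) * x \<le> u z * 1"
        using x uz by (intro mult_mono) auto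
      then show ?thesis using z(2)[of x] 3 x by simp
    qed
  qed
qed

text \<open>
  With \<open>g = h / u\<close> and \<open>\<phi> = h' - (u' / u) h = u g'\<close>, the first summand of \<open>G\<close> completes the
  square to \<open>P \<phi>\<^sup>2\<close> (Jacobi), and the second one contributes the integrand of Hardy's inequality,
  which controls \<open>g\<close> near the singular endpoint \<open>0\<close> by \<open>\<phi>\<close>.
  At \<open>0\<close> the division by \<open>u 0 = 0\<close> yields \<open>0\<close>, which is the limit of \<open>G\<close> there.
\<close>

lemma jacobi_coercive:
  assumes contP: "continuous_on {0..1} P" and posP: "\<forall>x\<in>{0..1}. P x > 0"
    and ivp: "jacobi_ivp P Q u" and posu: "\<forall>x\<in>{0<..1}. u x > 0"
  obtains c where "c > 0"
    "\<And>h. h \<in> C1_0 \<Longrightarrow> \<exists>G G'. continuous_on {0..1} G \<and> G 0 = 0 \<and> G 1 = 0 \<and>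
       (\<forall>x\<in>{0<..<1}. (G has_real_derivative G' x) (at x) \<and>
          P x * (D01 h x)\<^sup>2 + Q x * (h x)\<^sup>2 - G' x \<ge> c * ((D01 h x)\<^sup>2 + (h x)\<^sup>2))"
proof -
  define u' where "u' = D01 u"
  define W where "W = (\<lambda>x. P x * u' x)"
  have u0: "u 0 = 0" "u' 0 = 1"
    using ivp by (auto simp: jacobi_ivp_def u'_def)
  have du: "(u has_real_derivative u' x) (at x within {0..1})" if "x \<in> {0..1}" for x
  proof -
    obtain d where "(u has_real_derivative d) (at x within {0..1})"
      using ivp \<open>x \<in> {0..1}\<close> unfolding jacobi_ivp_def differentiable_on_def
      by (meson real_differentiableE)
    then show ?thesis
      using D01_eqI \<open>x \<in> {0..1}\<close> unfolding u'_def by blast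
  qed
  have dW: "(W has_real_derivative Q x * u x) (at x within {0..1})" if "x \<in> {0..1}" for x
    using ivp that unfolding jacobi_ivp_def W_def u'_def by blast
  have contu: "continuous_on {0..1} u" and contW: "continuous_on {0..1} W"
    by (rule DERIV_continuous_on[OF du], assumption, rule DERIV_continuous_on[OF dW])
  \<comment> \<open>The Jacobi equation makes \<open>W = P u'\<close> differentiable, hence
    continuous; dividing by the positive \<open>P\<close> transfers continuity to
    \<open>u'\<close>.\<close>
  have contu': "continuous_on {0..1} u'"
  proof -
    have "continuous_on {0..1} (\<lambda>x. W x / P x)"
      using contW contP posP by (intro continuous_intros) (auto simp: less_le)
    moreover have "W x / P x = u' x" if "x \<in> {0..1}" for x
      using posP that by (force simp: W_def)
    ultimately show ?thesis
      using continuous_on_cong by (metis (no_types, lifting))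
  qed
  obtain M where M: "M > 0" "\<And>x. x \<in> {0..1} \<Longrightarrow> \<bar>u' x\<bar> \<le> M"
    using continuous_on_bounded_01[OF contu'] by blast
  obtain N where N: "N > 0" "\<And>x. x \<in> {0..1} \<Longrightarrow> \<bar>u x\<bar> \<le> N"
    using continuous_on_bounded_01[OF contu] by blast
  obtain L where L: "L > 0" "\<And>x. x \<in> {0..1} \<Longrightarrow> \<bar>W x\<bar> \<le> L"
    using continuous_on_bounded_01[OF contW] by blast
  obtain a where a: "a > 0" "\<And>x. x \<in> {0..1} \<Longrightarrow> a * x \<le> u x"
    using linear_lower_bound[of u] du[of 0] u0 contu posu by auto
  obtain p where p: "p > 0" "\<And>x. x \<in> {0..1} \<Longrightarrow> p \<le> P x"
    using continuous_attains_inf[of "{0..1}" P] contP posP by fastforce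
  \<comment> \<open>\<open>lam\<close> makes the loss \<open>2 * lam / a\<^sup>2\<close> in the
    Hardy term equal to \<open>p / 2\<close>, half of what \<open>P\<close> provides.
    \<open>c\<close> is then small enough to return from \<open>\<phi>\<close> and \<open>g\<close>
    to \<open>h'\<close> and \<open>h\<close>.\<close>
  define lam where "lam = p * a\<^sup>2 / 4"
  define c where "c = min (p / 4) (lam / (2 * (2 * M\<^sup>2 + N\<^sup>2)))"
  have lam: "lam > 0"
    using p a by (simp add: lam_def)
  have MN: "2 * M\<^sup>2 + N\<^sup>2 > 0"
    using M N by (simp add: add_pos_pos)
  have c: "c > 0" "2 * c \<le> p / 2" "c * (2 * M\<^sup>2 + N\<^sup>2) \<le> lam / 2"
  proof -
    show "c > 0" "2 * c \<le> p / 2"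
      using p lam MN by (auto simp: c_def)
    have "c \<le> lam / (2 * (2 * M\<^sup>2 + N\<^sup>2))"
      by (simp add: c_def)
    then show "c * (2 * M\<^sup>2 + N\<^sup>2) \<le> lam / 2"
      using MN by (simp add: field_simps)
  qed
  show ?thesis
  proof (rule that[OF c(1)])
    fix h assume h: "h \<in> C1_0"
    define h' where "h' = D01 h"
    have h01: "h 0 = 0" "h 1 = 0" and Ckh: "Ck_on 1 {0..1} h"
      using h by (auto simp: C1_0_def)
    have dh: "(h has_real_derivative h' x) (at x within {0..1})" if "x \<in> {0..1}" for x
      unfolding h'_def by (rule Ck_on_1_D01(1)[OF Ckh that])
    have conth: "continuous_on {0..1} h"
      by (rule Ck_on_imp_continuous_on[OF Ckh])
    obtain K where K: "K > 0" "\<And>x. x \<in> {0..1} \<Longrightarrow> \<bar>h' x\<bar> \<le> K"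
      using continuous_on_bounded_01[OF Ck_on_1_D01(2)[OF Ckh]] unfolding h'_def by blast
    define g where "g = (\<lambda>x. h x / u x)"
    define \<phi> where "\<phi> = (\<lambda>x. h' x - u' x * g x)"
    define G where "G = (\<lambda>x. W x * h x * g x - lam * x * (g x)\<^sup>2)"
    \<comment> \<open>The derivative of \<open>G\<close>, simplified by
      \<open>g' = \<phi> / u\<close> and \<open>h = u * g\<close>: the Jacobi equation turns
      \<open>W' h g\<close> into \<open>Q h\<^sup>2\<close>, and \<open>W h g'\<close> becomes
      \<open>W g \<phi>\<close>.\<close>
    define G' where "G' = (\<lambda>x. Q x * (h x)\<^sup>2 + W x * h' x * g x + W x * g x * \<phi> x
      - lam * ((g x)\<^sup>2 + 2 * x * g x * \<phi> x / u x))"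
    have hK: "\<bar>h x\<bar> \<le> K * x" if "x \<in> {0..1}" for x
      using abs_le_mult_of_derivative_bound[of h h' K x] dh K h01 that by blast
    \<comment> \<open>The zero of \<open>h\<close> at 0 compensates that of \<open>u\<close>:
      \<open>h\<close> is at most \<open>K * x\<close> in absolute value and \<open>u\<close> is at
      least \<open>a * x\<close>.\<close>
    have gK: "\<bar>g x\<bar> \<le> K / a" if "x \<in> {0..1}" for x
    proof (cases "x = 0")
      case True
      then show ?thesis using K a u0 by (simp add: g_def)
    next
      case False
      then have x: "x > 0" "a * x > 0" using that a by auto
      have "\<bar>g x\<bar> \<le> K * x / (a * x)"
        unfolding g_def abs_divide using hK[OF that] a(2)[OF that] x K
        by (intro frac_le) auto
      then show ?thesis using x by simp
    qed
    have "continuous_on {0..1} G"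
      unfolding continuous_on_eq_continuous_within
    proof
      fix x :: real assume x: "x \<in> {0..1}"
      show "continuous (at x within {0..1}) G"
      proof (cases "x = 0")
        case False
        then have ux: "u x \<noteq> 0"
          using bspec[OF posu, of x] x by auto
        have "continuous (at x within {0..1}) u" "continuous (at x within {0..1}) W"
          "continuous (at x within {0..1}) h"
          using contu contW conth x by (simp_all add: continuous_on_eq_continuous_within)
        with ux show ?thesis
          unfolding G_def g_def
          by (intro continuous_intros continuous_at_within_divide)
      next
        case True
        \<comment> \<open>With \<open>g\<close> bounded, each summand of \<open>G\<close> keeps one
          factor of order \<open>x\<close>: \<open>h\<close> in the first, the explicit
          \<open>x\<close> in the second.\<close>
        have "(G \<longlongrightarrow> 0) (at 0 within {0..1})"
        proof (rule Lim_null_comparison)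
          show "\<forall>\<^sub>F x in at 0 within {0..1}. norm (G x) \<le> (L * K * (K / a) + lam * (K / a)\<^sup>2) * x"
            unfolding eventually_at
          proof (intro exI[of _ 1] conjI ballI impI)
            fix x :: real assume x: "x \<in> {0..1}"
            have "\<bar>W x * h x * g x\<bar> \<le> L * (K * x) * (K / a)"
              unfolding abs_mult using L K a x hK gK by (intro mult_mono) auto
            moreover have "\<bar>lam * x * (g x)\<^sup>2\<bar> \<le> lam * x * (K / a)\<^sup>2"
              unfolding abs_mult power2_abs abs_power2 power2_eq_square[of "K / a"]
                power2_eq_square[of "g x"]
              using lam x gK[OF x] K a by (intro mult_mono) auto
            ultimately show "norm (G x) \<le> (L * K * (K / a) + lam * (K / a)\<^sup>2) * x"
              unfolding G_def by (simp add: algebra_simps)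
          qed simp
          show "((\<lambda>x. (L * K * (K / a) + lam * (K / a)\<^sup>2) * x) \<longlongrightarrow> 0) (at 0 within {0..1})"
            by (auto intro!: tendsto_eq_intros)
        qed
        then show ?thesis
          using True u0 by (simp add: continuous_within G_def g_def)
      qed
    qed
    moreover have "G 0 = 0" "G 1 = 0"
      using h01 by (auto simp: G_def g_def)
    moreover have "(G has_real_derivative G' x) (at x) \<and>
        P x * (h' x)\<^sup>2 + Q x * (h x)\<^sup>2 - G' x \<ge> c * ((h' x)\<^sup>2 + (h x)\<^sup>2)"
      if x: "x \<in> {0<..<1}" for x
    proof
      have x': "x \<in> {0..1}" and at: "at x within {0..1} = at x"
        using x at_within_Icc_at[of 0 x 1] by auto
      have ux: "u x > 0"
        using posu x by auto
      have hx: "h x = u x * g x"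
        using ux by (simp add: g_def)
      have du_at: "(u has_real_derivative u' x) (at x)" and dh_at: "(h has_real_derivative h' x) (at x)"
        and dW_at: "(W has_real_derivative Q x * u x) (at x)"
        using du[OF x'] dh[OF x'] dW[OF x'] at by auto
      have dg: "(g has_real_derivative \<phi> x / u x) (at x)"
        unfolding g_def
        by (rule DERIV_cong[OF DERIV_divide[OF dh_at du_at]])
           (use ux in \<open>auto simp: \<phi>_def g_def field_simps\<close>)
      show "(G has_real_derivative G' x) (at x)"
        unfolding G_def
        by (rule derivative_eq_intros dW_at dh_at dg refl)+
           (use ux in \<open>simp add: G'_def hx field_simps power2_eq_square\<close>)
      have h'x: "h' x = \<phi> x + u' x * g x"
        by (simp add: \<phi>_def)
      define q where "q = x / (u x)"
      have q: "\<bar>q\<bar> \<le> 1 / a"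
        using a(1) a(2)[OF x'] ux x by (simp add: q_def field_simps)
      \<comment> \<open>Substituting \<open>W = P u'\<close> and \<open>h' = \<phi> + u' g\<close>
        cancels the cross terms and \<open>Q h\<^sup>2\<close>, leaving the square
        \<open>P \<phi>\<^sup>2\<close> and the Hardy term.\<close>
      have eq: "P x * (h' x)\<^sup>2 + Q x * (h x)\<^sup>2 - G' x
          = P x * (\<phi> x)\<^sup>2 + lam * ((g x)\<^sup>2 + 2 * (q * \<phi> x) * g x)"
        unfolding G'_def W_def h'x q_def by (simp add: algebra_simps power2_eq_square)
      have low: "P x * (\<phi> x)\<^sup>2 + lam * ((g x)\<^sup>2 + 2 * (q * \<phi> x) * g x)
          \<ge> p / 2 * (\<phi> x)\<^sup>2 + lam / 2 * (g x)\<^sup>2"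
      proof -
        \<comment> \<open>This weighting of the square absorbs the cross term at the price of half
          of \<open>g\<^sup>2\<close> and a multiple of \<open>\<phi>\<^sup>2\<close>, which
          \<open>P \<phi>\<^sup>2\<close> can pay.\<close>
        have "0 \<le> (g x + 2 * (q * \<phi> x))\<^sup>2"
          by simp
        then have "(g x)\<^sup>2 + 2 * (q * \<phi> x) * g x \<ge> (g x)\<^sup>2 / 2 - 2 * (q * \<phi> x)\<^sup>2"
          by (simp add: power2_eq_square algebra_simps)
        moreover have "(q * \<phi> x)\<^sup>2 \<le> (\<phi> x)\<^sup>2 / a\<^sup>2"
        proof -
          have "q\<^sup>2 \<le> (1 / a)\<^sup>2"
            using q by (metis abs_ge_zero power2_abs power_mono)
          from mult_right_mono[OF this, of "(\<phi> x)\<^sup>2"] show ?thesis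
            by (simp add: power_mult_distrib power_divide)
        qed
        ultimately have "(g x)\<^sup>2 + 2 * (q * \<phi> x) * g x \<ge> (g x)\<^sup>2 / 2 - 2 * ((\<phi> x)\<^sup>2 / a\<^sup>2)"
          by linarith
        from mult_left_mono[OF this, of lam]
        have "lam * ((g x)\<^sup>2 + 2 * (q * \<phi> x) * g x)
            \<ge> lam * ((g x)\<^sup>2 / 2 - 2 * ((\<phi> x)\<^sup>2 / a\<^sup>2))"
          using lam by simp
        moreover have "lam * ((g x)\<^sup>2 / 2 - 2 * ((\<phi> x)\<^sup>2 / a\<^sup>2))
            = lam / 2 * (g x)\<^sup>2 - p / 2 * (\<phi> x)\<^sup>2"
          using a(1) by (simp add: lam_def field_simps)
        ultimately have "lam * ((g x)\<^sup>2 + 2 * (q * \<phi> x) * g x) \<ge> lam / 2 * (g x)\<^sup>2 - p / 2 * (\<phi> x)\<^sup>2"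
          by linarith
        moreover have "P x * (\<phi> x)\<^sup>2 \<ge> p * (\<phi> x)\<^sup>2"
          using p(2)[OF x'] by (intro mult_right_mono) auto
        ultimately show ?thesis by linarith
      qed
      \<comment> \<open>Back to \<open>h\<close>: both \<open>h'\<close> and \<open>h\<close> are
        linear combinations of \<open>\<phi>\<close> and \<open>g\<close> with bounded
        coefficients.\<close>
      have "p / 2 * (\<phi> x)\<^sup>2 + lam / 2 * (g x)\<^sup>2 \<ge> c * ((h' x)\<^sup>2 + (h x)\<^sup>2)"
      proof -
        have "0 \<le> (\<phi> x - u' x * g x)\<^sup>2"
          by simp
        then have "(h' x)\<^sup>2 \<le> 2 * (\<phi> x)\<^sup>2 + 2 * ((u' x)\<^sup>2 * (g x)\<^sup>2)"
          unfolding h'x by (simp add: power2_eq_square algebra_simps)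
        also have "(u' x)\<^sup>2 * (g x)\<^sup>2 \<le> M\<^sup>2 * (g x)\<^sup>2"
          using M(2)[OF x'] by (intro mult_right_mono) (auto simp: power2_le_iff_abs_le M(1) less_imp_le)
        finally have 1: "(h' x)\<^sup>2 \<le> 2 * (\<phi> x)\<^sup>2 + 2 * (M\<^sup>2 * (g x)\<^sup>2)"
          by simp
        have 2: "(h x)\<^sup>2 \<le> N\<^sup>2 * (g x)\<^sup>2"
          unfolding hx power_mult_distrib
          using N(2)[OF x'] by (intro mult_right_mono) (auto simp: power2_le_iff_abs_le N(1) less_imp_le)
        have "c * ((h' x)\<^sup>2 + (h x)\<^sup>2) \<le> c * (2 * (\<phi> x)\<^sup>2 + (2 * M\<^sup>2 + N\<^sup>2) * (g x)\<^sup>2)"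
          using 1 2 c(1) by (intro mult_left_mono) (auto simp: algebra_simps)
        also have "\<dots> = 2 * c * (\<phi> x)\<^sup>2 + c * (2 * M\<^sup>2 + N\<^sup>2) * (g x)\<^sup>2"
          by (simp add: algebra_simps)
        also have "\<dots> \<le> p / 2 * (\<phi> x)\<^sup>2 + lam / 2 * (g x)\<^sup>2"
          using c by (intro add_mono mult_right_mono) auto
        finally show ?thesis .
      qed
      with eq low show "P x * (h' x)\<^sup>2 + Q x * (h x)\<^sup>2 - G' x \<ge> c * ((h' x)\<^sup>2 + (h x)\<^sup>2)"
        by linarith
    qed
    ultimately show "\<exists>G G'. continuous_on {0..1} G \<and> G 0 = 0 \<and> G 1 = 0 \<and>
       (\<forall>x\<in>{0<..<1}. (G has_real_derivative G' x) (at x) \<and>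
          P x * (D01 h x)\<^sup>2 + Q x * (h x)\<^sup>2 - G' x \<ge> c * ((D01 h x)\<^sup>2 + (h x)\<^sup>2))"
      unfolding h'_def by blast
  qed
qed

section \<open>From pointwise estimates to the functional\<close>

text \<open>Compactness bounds \<open>h\<close> and \<open>D01 h\<close>, so the suprema are true
  upper bounds. Smallness in \<open>C1_norm\<close> thus gives the pointwise smallness that the
  Taylor estimate asks for.\<close>

lemma abs_le_C1_norm:
  assumes "Ck_on 1 {0..1} h" "x \<in> {0..1}"
  shows "\<bar>D01 h x\<bar> + \<bar>h x\<bar> \<le> C1_norm h"
proof -
  have le: "\<bar>g x\<bar> \<le> (SUP x\<in>{0..1}. \<bar>g x\<bar>)" if cont: "continuous_on {0..1} g" for g :: "real \<Rightarrow> real"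
  proof -
    obtain M where "\<And>x. x \<in> {0..1} \<Longrightarrow> \<bar>g x\<bar> \<le> M"
      using continuous_on_bounded_01[OF cont] by blast
    then have "bdd_above ((\<lambda>x. \<bar>g x\<bar>) ` {0..1})"
      by (rule bdd_aboveI2)
    then show ?thesis
      by (rule cSUP_upper[OF assms(2)])
  qed
  show ?thesis
    using le[OF Ck_on_1_D01(2)[OF assms(1)]] le[OF Ck_on_imp_continuous_on[OF assms(1)]]
    unfolding C1_norm_def by linarith
qed

text \<open>The integral of \<open>T'\<close> vanishes because the endpoint values of
  \<open>T\<close> agree, and a continuous nonnegative \<open>S\<close> that is not identically zero
  has positive integral. Integrability of \<open>T'\<close> comes from the fundamental theorem for
  the gauge integral, with derivatives on the open interval.\<close>

lemma coercive_integral_pos: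
  fixes D T T' S :: "real \<Rightarrow> real"
  assumes contT: "continuous_on {0..1} T" and ends: "T 0 = T 1"
    and dT: "\<And>x. x \<in> {0<..<1} \<Longrightarrow> (T has_real_derivative T' x) (at x)"
    and le: "\<And>x. x \<in> {0<..<1} \<Longrightarrow> T' x + S x \<le> D x"
    and contD: "continuous_on {0..1} D" and contS: "continuous_on {0..1} S"
    and S: "\<And>x. x \<in> {0..1} \<Longrightarrow> 0 \<le> S x" "\<exists>x\<in>{0..1}. S x \<noteq> 0"
  shows "integral {0..1} D > 0"
proof -
  have "(T' has_integral T 1 - T 0) {0..1}"
    by (rule fundamental_theorem_of_calculus_interior[OF _ contT])
       (use dT in \<open>auto simp: has_real_derivative_iff_has_vector_derivative\<close>)
  then have "((\<lambda>x. T' x + S x) has_integral 0 + integral {0..1} S) {0..1}"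
    using ends contS by (intro has_integral_add integrable_integral integrable_continuous_interval) auto
  moreover have "(D has_integral integral {0..1} D) {0..1}"
    using contD by (intro integrable_integral integrable_continuous_interval)
  \<comment> \<open>The pointwise inequality is known on the open interval, so the integrals are
    moved there before being compared.\<close>
  ultimately have "0 + integral {0..1} S \<le> integral {0..1} D"
    unfolding has_integral_Icc_iff_Ioo by (rule has_integral_le) (use le in auto)
  moreover have "integral {0..1} S \<noteq> 0"
    using integral_eq_0_iff[OF contS] S by auto
  moreover have "0 \<le> integral {0..1} S"
    using S by (intro integral_nonneg integrable_continuous_interval contS) auto
  ultimately show ?thesis by linarith
qed

theorem corollary3p1:
  fixes f :: "real \<times> real \<times> real \<Rightarrow> real" and y u :: "real \<Rightarrow> real"
  assumes "y \<in> C1_0"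
    and "Ck_on 2 (UNIV \<times> UNIV \<times> {0..1}) f"
    and "euler_equation f y"
    and "Ck_on 1 {0..1} (coeff_P f y)"
    and "\<forall>x\<in>{0..1}. coeff_P f y x > 0"
    and "Ck_on 1 {0..1} (coeff_R f y)"
    and "jacobi_ivp (coeff_P f y) (coeff_Q f y) u"
    and "\<forall>x\<in>{0<..1}. u x > 0"
  shows "strict_local_minimizer (functional f) y"
proof -
  note y = assms(1) and f = assms(2) and euler = assms(3)
  define P where "P = coeff_P f y"
  define Q where "Q = coeff_Q f y"
  define R where "R = coeff_R f y"
  define A where "A x = (D01 y x, y x, x)" for x
  have Cky: "Ck_on 1 {0..1} y"
    using y by (simp add: C1_0_def)
  note dy = Ck_on_1_D01(1)[OF Cky] and conty' = Ck_on_1_D01(2)[OF Cky]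
  have conty: "continuous_on {0..1} y"
    by (rule Ck_on_imp_continuous_on[OF Cky])
  have contf: "continuous_on strip f"
    by (rule Ck_on_imp_continuous_on[OF f])
  have CkR: "Ck_on 1 {0..1} R"
    using assms(6) by (simp add: R_def)
  have P: "continuous_on {0..1} P" "\<forall>x\<in>{0..1}. P x > 0"
    using Ck_on_imp_continuous_on[OF assms(4)] assms(5) by (auto simp: P_def)
  obtain c where c: "c > 0" and coercive:
    "\<And>h. h \<in> C1_0 \<Longrightarrow> \<exists>G G'. continuous_on {0..1} G \<and> G 0 = 0 \<and> G 1 = 0 \<and>
       (\<forall>x\<in>{0<..<1}. (G has_real_derivative G' x) (at x) \<and>
          P x * (D01 h x)\<^sup>2 + Q x * (h x)\<^sup>2 - G' x \<ge> c * ((D01 h x)\<^sup>2 + (h x)\<^sup>2))"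
    using jacobi_coercive[OF P, of Q u] assms(7,8) by (auto simp: P_def Q_def)
  obtain B1 B2 where B: "\<And>x. x \<in> {0..1} \<Longrightarrow> \<bar>D01 y x\<bar> \<le> B1" "\<And>x. x \<in> {0..1} \<Longrightarrow> \<bar>y x\<bar> \<le> B2"
    using continuous_on_bounded_01[OF conty'] continuous_on_bounded_01[OF conty] by metis
  \<comment> \<open>Half of the coercive quadratic form contributes \<open>c / 2\<close>. Taylor
    errors of size \<open>c / 4\<close> leave \<open>c / 4\<close>, the constant in
    \<open>S\<close>.\<close>
  obtain \<delta> where "\<delta> > 0" and taylor: "\<And>a b x k1 k2. x \<in> {0..1} \<Longrightarrow> \<bar>a\<bar> \<le> max B1 B2 \<Longrightarrow>
    \<bar>b\<bar> \<le> max B1 B2 \<Longrightarrow> \<bar>k1\<bar> + \<bar>k2\<bar> < \<delta> \<Longrightarrow>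
    f (a + k1, b + k2, x) - f (a, b, x) \<ge>
      dz1 f (a, b, x) * k1 + dz2 f (a, b, x) * k2
      + (dz1 (dz1 f) (a, b, x) * k1\<^sup>2 + 2 * dz1 (dz2 f) (a, b, x) * k1 * k2
         + dz2 (dz2 f) (a, b, x) * k2\<^sup>2) / 2
      - c / 4 * (k1\<^sup>2 + k2\<^sup>2)"
    using taylor_integrand[OF f, of "c / 4" "max B1 B2"] c by auto
  have "functional f (\<lambda>x. y x + h x) > functional f y"
    if h: "h \<in> C1_0" and nz: "\<exists>x\<in>{0..1}. h x \<noteq> 0" and small: "C1_norm h < \<delta>" for h
  proof -
    have h01: "h 0 = 0" "h 1 = 0" and Ckh: "Ck_on 1 {0..1} h"
      using h by (auto simp: C1_0_def)
    note dh = Ck_on_1_D01(1)[OF Ckh] and conth' = Ck_on_1_D01(2)[OF Ckh]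
    have conth: "continuous_on {0..1} h"
      by (rule Ck_on_imp_continuous_on[OF Ckh])
    obtain G G' where G: "continuous_on {0..1} G" "G 0 = 0" "G 1 = 0"
      and dG: "\<And>x. x \<in> {0<..<1} \<Longrightarrow> (G has_real_derivative G' x) (at x)"
      and G'_le: "\<And>x. x \<in> {0<..<1} \<Longrightarrow>
          P x * (D01 h x)\<^sup>2 + Q x * (h x)\<^sup>2 - G' x \<ge> c * ((D01 h x)\<^sup>2 + (h x)\<^sup>2)"
      using coercive[OF h] by blast
    define D where "D x = f (D01 y x + D01 h x, y x + h x, x) - f (A x)" for x
    define S where "S x = c / 4 * ((D01 h x)\<^sup>2 + (h x)\<^sup>2)" for x
    \<comment> \<open>\<open>T\<close> collects all exact derivatives: the first-order part by the
      Euler equation, and half of \<open>R h\<^sup>2 + G\<close> from the second-order part. Each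
      summand vanishes at both endpoints.\<close>
    define T where "T x = dz1 f (A x) * h x + 1 / 2 * (R x * (h x)\<^sup>2 + G x)" for x
    define T' where "T' x = dz2 f (A x) * h x + dz1 f (A x) * D01 h x
      + (D01 R x * (h x)\<^sup>2 + 2 * R x * h x * D01 h x + G' x) / 2" for x
    have de: "((\<lambda>t. dz1 f (A t)) has_real_derivative dz2 f (A x)) (at x within {0..1})"
      if "x \<in> {0..1}" for x
      using euler that unfolding euler_equation_def A_def by blast
    have contA: "continuous_on {0..1} (\<lambda>x. f (A x))"
      and contAh: "continuous_on {0..1} (\<lambda>x. f (D01 y x + D01 h x, y x + h x, x))"
      unfolding A_def using conty conty' conth conth'
      by (auto intro!: continuous_on_compose2[OF contf] continuous_intros)
    have "integral {0..1} D > 0"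
    proof (rule coercive_integral_pos)
      show "continuous_on {0..1} T"
        unfolding T_def using DERIV_continuous_on[OF de] conth G(1) Ck_on_imp_continuous_on[OF CkR]
        by (intro continuous_intros) auto
      show "T 0 = T 1"
        using h01 G by (simp add: T_def)
      show "continuous_on {0..1} D"
        unfolding D_def using contA contAh by (intro continuous_intros)
      show "continuous_on {0..1} S"
        unfolding S_def using conth conth' by (intro continuous_intros)
      show "0 \<le> S x" for x
        using c by (simp add: S_def)
      show "\<exists>x\<in>{0..1}. S x \<noteq> 0"
        using nz c by (auto simp: S_def sum_power2_eq_zero_iff)
    next
      fix x :: real assume x: "x \<in> {0<..<1}"
      then have x': "x \<in> {0..1}" and at: "at x within {0..1} = at x"
        using at_within_Icc_at[of 0 x 1] by auto
      have "((\<lambda>t. dz1 f (A t)) has_real_derivative dz2 f (A x)) (at x)"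
        "(h has_real_derivative D01 h x) (at x)" "(R has_real_derivative D01 R x) (at x)"
        using de[OF x'] dh[OF x'] Ck_on_1_D01(1)[OF CkR x'] at by auto
      note ders = this dG[OF x]
      show "(T has_real_derivative T' x) (at x)"
        unfolding T_def by (rule derivative_eq_intros ders refl)+ (simp add: T'_def algebra_simps)
      have "D x \<ge> dz1 f (A x) * D01 h x + dz2 f (A x) * h x
        + (dz1 (dz1 f) (A x) * (D01 h x)\<^sup>2 + 2 * dz1 (dz2 f) (A x) * D01 h x * h x
           + dz2 (dz2 f) (A x) * (h x)\<^sup>2) / 2
        - c / 4 * ((D01 h x)\<^sup>2 + (h x)\<^sup>2)"
        unfolding D_def A_def
        by (rule taylor[OF x']) (use B[OF x'] abs_le_C1_norm[OF Ckh x'] small in auto)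
      \<comment> \<open>The term \<open>D01 R\<close> reappears because \<open>coeff_Q\<close>
        subtracts it; together with the mixed term it matches the derivative of
        \<open>R h\<^sup>2\<close> in \<open>T'\<close>.\<close>
      moreover have "dz1 (dz1 f) (A x) = P x" "dz1 (dz2 f) (A x) = R x"
        "dz2 (dz2 f) (A x) = Q x + D01 R x"
        by (simp_all add: A_def P_def Q_def R_def coeff_P_def coeff_Q_def coeff_R_def)
      ultimately show "T' x + S x \<le> D x"
        using G'_le[OF x] unfolding T'_def S_def by (simp add: algebra_simps add_divide_distrib)
    qed
    moreover have "D01 (\<lambda>x. y x + h x) x = D01 y x + D01 h x" if "x \<in> {0..1}" for x
      using D01_eqI[OF DERIV_add[OF dy dh]] that by blast
    then have "functional f (\<lambda>x. y x + h x)
        = integral {0..1} (\<lambda>x. f (D01 y x + D01 h x, y x + h x, x))"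
      unfolding functional_def by (intro Henstock_Kurzweil_Integration.integral_cong) simp
    moreover have "functional f y = integral {0..1} (\<lambda>x. f (A x))"
      by (simp add: functional_def A_def)
    moreover have "integral {0..1} D
        = integral {0..1} (\<lambda>x. f (D01 y x + D01 h x, y x + h x, x)) - integral {0..1} (\<lambda>x. f (A x))"
      unfolding D_def using contA contAh
      by (intro Henstock_Kurzweil_Integration.integral_diff integrable_continuous_interval)
    ultimately show ?thesis by simp
  qed
  then show ?thesis
    using y \<open>\<delta> > 0\<close> unfolding strict_local_minimizer_def by blast
qed

end
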